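(* Let $\mathcal X_n$ be a finite set with $n$ elements (graph vertices) with symmetric edge weights $w_{xy}=w_{yx}\ge0$ and $\deg(x)=\sum_{y\in\mathcal X_n}w_{xy}>0$ for all $x\in\mathcal X_n$. Suppose that $u:\mathcal X_n\to\mathbb R$ satisfies the Poisson equation $$\mathcal Lu=\sum_{y\in\Gamma}a_y\delta_y\quad\text{on }\mathcal X_n,$$ where $\Gamma\subset\mathcal X_n$ and $a_y\in\mathbb R$ for $y\in\Gamma$. Then for every integer $k\ge0$ the function $u_k:=\mathcal H_k*u$ satisfies the Poisson equation $$\mathcal Lu_k=\sum_{y\in\Gamma}a_y\mathcal H^y_k\quad\text{on }\mathcal X_n.$$
   Context: $\mathcal Lu(x)=\sum_{y\in\mathcal X_n}w_{xy}(u(x)-u(y))$ is the unnormalized graph Laplacian. For $x\in\mathcal X_n$, $\delta_x:\mathcal X_n\to\mathbb R$ is $\delta_x(x)=n$ and $\delta_x(y)=0$ for $y\ne x$. The heat kernel $\mathcal H^x_k:\mathcal X_n\to\mathbb R$ is defined by $\mathcal H^x_0=\delta_x$ and $\mathcal H^x_{k+1}(y)=\sum_{z\in\mathcal X_n}\frac{w_{yz}}{\deg(z)}\mathcal H^x_k(z)$ for $k\ge0$. Convolution with the heat kernel: $(\mathcal H_k*u)(x)=\frac1n\sum_{y\in\mathcal X_n}\mathcal H^x_k(y)u(y)$. *)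

theory Defs
  imports Complex_Main
begin

text \<open>
  A weighted graph is a finite vertex set \<open>X\<close> inside a type \<open>'a\<close> with weights
  \<open>w :: 'a \<Rightarrow> 'a \<Rightarrow> real\<close>. Real functions on \<open>X\<close> are represented by total functions on \<open>'a\<close>
  whose values outside \<open>X\<close> carry no meaning; every sum ranges over \<open>X\<close>, and equations
  between such functions are to be read pointwise on \<open>X\<close>. The number of vertices is \<open>card X\<close>.
\<close>

definition degree :: "'a set \<Rightarrow> ('a \<Rightarrow> 'a \<Rightarrow> real) \<Rightarrow> 'a \<Rightarrow> real" where
  "degree X w x = (\<Sum>y\<in>X. w x y)"

definition graph_laplacian ::
  "'a set \<Rightarrow> ('a \<Rightarrow> 'a \<Rightarrow> real) \<Rightarrow> ('a \<Rightarrow> real) \<Rightarrow> 'a \<Rightarrow> real" where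
  "graph_laplacian X w u x = (\<Sum>y\<in>X. w x y * (u x - u y))"

definition delta :: "'a set \<Rightarrow> 'a \<Rightarrow> 'a \<Rightarrow> real" where
  "delta X x y = (if y = x then real (card X) else 0)"

text \<open>
  \<open>heat_kernel X w k x y\<close> is $\mathcal{H}^x_k(y)$: \<open>x\<close> is the source vertex and the kernel
  is a function of \<open>y\<close>.
\<close>

primrec heat_kernel ::
  "'a set \<Rightarrow> ('a \<Rightarrow> 'a \<Rightarrow> real) \<Rightarrow> nat \<Rightarrow> 'a \<Rightarrow> 'a \<Rightarrow> real" where
  "heat_kernel X w 0 x = delta X x"
| "heat_kernel X w (Suc k) x =
     (\<lambda>y. \<Sum>z\<in>X. w y z / degree X w z * heat_kernel X w k x z)"

definition heat_convolution ::
  "'a set \<Rightarrow> ('a \<Rightarrow> 'a \<Rightarrow> real) \<Rightarrow> nat \<Rightarrow> ('a \<Rightarrow> real) \<Rightarrow> 'a \<Rightarrow> real" where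
  "heat_convolution X w k u x =
     1 / real (card X) * (\<Sum>y\<in>X. heat_kernel X w k x y * u y)"

end

theory Submission
  imports Defs
begin

text \<open>
  In matrix terms, with \<open>D\<close> the degrees and \<open>W\<close> the weights, the heat kernel iterates
  $A = W D^{-1}$, while convolution with it iterates the transpose $P = D^{-1} W$.
  Since $\mathcal{L} = D - W$, we have $\mathcal{L} P = W - W D^{-1} W = A \mathcal{L}$, whence
  $\mathcal{L} u_k = \mathcal{L} P^k u = A^k \mathcal{L} u = \sum_{y} a_y A^k \delta_y$.
\<close>

definition heat_step :: "'a set \<Rightarrow> ('a \<Rightarrow> 'a \<Rightarrow> real) \<Rightarrow> ('a \<Rightarrow> real) \<Rightarrow> 'a \<Rightarrow> real" where
  "heat_step X w f y = (\<Sum>z\<in>X. w y z / degree X w z * f z)"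

text \<open>The operator $P$ above: the mean of \<open>u\<close> after one random walk step from
  \<open>x\<close>. For symmetric weights its matrix is the transpose of that of
  \<open>heat_step\<close>.\<close>

definition walk_average :: "'a set \<Rightarrow> ('a \<Rightarrow> 'a \<Rightarrow> real) \<Rightarrow> ('a \<Rightarrow> real) \<Rightarrow> 'a \<Rightarrow> real" where
  "walk_average X w u x = (\<Sum>y\<in>X. w x y * u y) / degree X w x"

lemma graph_laplacian_eq:
  "graph_laplacian X w u x = degree X w x * u x - (\<Sum>y\<in>X. w x y * u y)"
  by (simp add: graph_laplacian_def degree_def sum_distrib_right right_diff_distrib sum_subtractf)

text \<open>Values off \<open>X\<close> are arbitrary, so some identities below hold only on
  \<open>X\<close>; the congruence rules carry them through the operators, which on \<open>X\<close>
  read only values there.\<close>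

lemma graph_laplacian_cong:
  assumes "\<And>y. y \<in> X \<Longrightarrow> u y = v y" and "x \<in> X"
  shows "graph_laplacian X w u x = graph_laplacian X w v x"
  using assms by (simp add: graph_laplacian_def)

lemma heat_step_cong:
  "(\<And>z. z \<in> X \<Longrightarrow> f z = g z) \<Longrightarrow> heat_step X w f y = heat_step X w g y"
  by (simp add: heat_step_def)

lemma heat_step_sum:
  "heat_step X w (\<lambda>z. \<Sum>i\<in>I. c i * f i z) y = (\<Sum>i\<in>I. c i * heat_step X w (f i) y)"
proof -
  have "heat_step X w (\<lambda>z. \<Sum>i\<in>I. c i * f i z) y
      = (\<Sum>z\<in>X. \<Sum>i\<in>I. c i * (w y z / degree X w z * f i z))"
    by (simp add: heat_step_def sum_distrib_left mult.left_commute)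
  also have "\<dots> = (\<Sum>i\<in>I. c i * heat_step X w (f i) y)"
    by (subst sum.swap) (simp add: heat_step_def sum_distrib_left)
  finally show ?thesis .
qed

text \<open>Both sides equal $W(I - P)u$: on the left $DP = W$, and on the right $D^{-1}(D - W) = I
  - P$. Each identity divides by degrees.\<close>

lemma graph_laplacian_walk_average:
  assumes "\<And>x. x \<in> X \<Longrightarrow> degree X w x \<noteq> 0" and "x \<in> X"
  shows "graph_laplacian X w (walk_average X w u) x = heat_step X w (graph_laplacian X w u) x"
proof -
  have "graph_laplacian X w (walk_average X w u) x
      = (\<Sum>z\<in>X. w x z * (u z - walk_average X w u z))"
    using assms
    by (simp add: graph_laplacian_eq walk_average_def right_diff_distrib sum_subtractf)
  also have "\<dots> = heat_step X w (graph_laplacian X w u) x"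
    unfolding heat_step_def
    using assms(1)
    by (intro sum.cong) (simp_all add: graph_laplacian_eq walk_average_def field_simps)
  finally show ?thesis .
qed

text \<open>The factor \<open>card X\<close> in \<open>delta\<close> cancels the normalization,
  being nonzero because the finite set \<open>X\<close> contains \<open>x\<close>.\<close>

lemma heat_convolution_0:
  assumes "finite X" and "x \<in> X"
  shows "heat_convolution X w 0 u x = u x"
proof -
  have "(\<Sum>y\<in>X. delta X x y * u y) = (\<Sum>y\<in>X. if y = x then real (card X) * u y else 0)"
    by (intro sum.cong) (simp_all add: delta_def)
  then show ?thesis
    using assms by (auto simp: heat_convolution_def)
qed

text \<open>Swapping the sums moves the last kernel step onto \<open>u\<close>; symmetry then turns
  \<open>w y z / degree X w z\<close> into the weight with which \<open>walk_average\<close> at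
  \<open>z\<close> counts \<open>u y\<close>.\<close>

lemma heat_convolution_Suc:
  assumes "\<And>x y. x \<in> X \<Longrightarrow> y \<in> X \<Longrightarrow> w x y = w y x"
  shows "heat_convolution X w (Suc k) u x = heat_convolution X w k (walk_average X w u) x"
proof -
  have "(\<Sum>y\<in>X. heat_kernel X w (Suc k) x y * u y)
      = (\<Sum>z\<in>X. \<Sum>y\<in>X. w y z / degree X w z * heat_kernel X w k x z * u y)"
    by (subst sum.swap) (simp add: sum_distrib_right)
  also have "\<dots> = (\<Sum>z\<in>X. heat_kernel X w k x z * walk_average X w u z)"
    unfolding walk_average_def sum_divide_distrib sum_distrib_left
    using assms by (intro sum.cong) simp_all
  finally show ?thesis
    by (simp add: heat_convolution_def)
qed

lemma graph_laplacian_heat_convolution: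
  assumes "finite X"
    and "\<And>x y. x \<in> X \<Longrightarrow> y \<in> X \<Longrightarrow> w x y = w y x"
    and "\<And>x. x \<in> X \<Longrightarrow> degree X w x \<noteq> 0"
    and "x \<in> X"
  shows "graph_laplacian X w (heat_convolution X w (Suc k) u) x
       = heat_step X w (graph_laplacian X w (heat_convolution X w k u)) x"
  using \<open>x \<in> X\<close>
\<comment> \<open>The recursion puts the new factor innermost, $P^{k+1}u = P^k(Pu)$, whereas the
  Laplacian meets the outermost one. Generalizing over \<open>u\<close> lets the induction
  hypothesis be applied to $Pu$, so no commutation of $P$ with $P^k$ has to be shown.\<close>
proof (induction k arbitrary: u x)
  case 0
  have "graph_laplacian X w (heat_convolution X w (Suc 0) u) x
      = graph_laplacian X w (walk_average X w u) x"
    using assms 0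
    by (intro graph_laplacian_cong) (simp_all add: heat_convolution_Suc heat_convolution_0)
  also have "\<dots> = heat_step X w (graph_laplacian X w u) x"
    using assms 0 by (intro graph_laplacian_walk_average)
  also have "\<dots> = heat_step X w (graph_laplacian X w (heat_convolution X w 0 u)) x"
    using assms by (intro heat_step_cong graph_laplacian_cong) (simp_all add: heat_convolution_0)
  finally show ?case .
next
  case (Suc k)
  \<comment> \<open>This holds at every point, not only on \<open>X\<close>, so it can rewrite the
    function inside the Laplacian on both sides.\<close>
  have shift: "heat_convolution X w (Suc j) u = heat_convolution X w j (walk_average X w u)" for j
    using assms(2) by (intro ext heat_convolution_Suc)
  show ?case
    unfolding shift[of "Suc k"] shift[of k] by (rule Suc.IH[OF Suc.prems])
qed

theorem theorem4p8:
  fixes X \<Gamma> :: "'a set"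
    and w :: "'a \<Rightarrow> 'a \<Rightarrow> real"
    and u a :: "'a \<Rightarrow> real"
  assumes "finite X"
    and "\<And>x y. x \<in> X \<Longrightarrow> y \<in> X \<Longrightarrow> w x y = w y x"
    and "\<And>x y. x \<in> X \<Longrightarrow> y \<in> X \<Longrightarrow> w x y \<ge> 0"
    and "\<And>x. x \<in> X \<Longrightarrow> degree X w x > 0"
    and "\<Gamma> \<subseteq> X"
    and "\<forall>x\<in>X. graph_laplacian X w u x = (\<Sum>y\<in>\<Gamma>. a y * delta X y x)"
  shows "\<forall>k. \<forall>x\<in>X. graph_laplacian X w (heat_convolution X w k u) x
                   = (\<Sum>y\<in>\<Gamma>. a y * heat_kernel X w k y x)"
proof (intro allI ballI)
  fix k x
  have deg: "degree X w x \<noteq> 0" if "x \<in> X" for x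
    using assms(4)[OF that] by simp
  assume "x \<in> X"
  then show "graph_laplacian X w (heat_convolution X w k u) x
           = (\<Sum>y\<in>\<Gamma>. a y * heat_kernel X w k y x)"
  proof (induction k arbitrary: x)
    case 0
    have "graph_laplacian X w (heat_convolution X w 0 u) x = graph_laplacian X w u x"
      using assms(1) 0 by (intro graph_laplacian_cong heat_convolution_0)
    then show ?case
      using assms(6) 0 by simp
  next
    case (Suc k)
    have "graph_laplacian X w (heat_convolution X w (Suc k) u) x
        = heat_step X w (graph_laplacian X w (heat_convolution X w k u)) x"
      using assms(1,2) deg Suc.prems by (rule graph_laplacian_heat_convolution)
    also have "\<dots> = heat_step X w (\<lambda>z. \<Sum>y\<in>\<Gamma>. a y * heat_kernel X w k y z) x"
      by (intro heat_step_cong Suc.IH)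
    \<comment> \<open>By linearity the step acts on each kernel separately; with the source
      \<open>y\<close> fixed, it is the defining recursion of \<open>heat_kernel\<close>.\<close>
    also have "\<dots> = (\<Sum>y\<in>\<Gamma>. a y * heat_kernel X w (Suc k) y x)"
      unfolding heat_step_sum by (simp add: heat_step_def)
    finally show ?case .
  qed
qed

end
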